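(* Let $f:\mathcal{S}^n\to\mathbb{R}$ be convex and continuous, let $A_1,\dots,A_m\in\mathcal{S}^n$, let $\mathcal{A}:\mathcal{S}^n\to\mathbb{R}^m$ be given by $\mathcal{A}(X)_i=\langle X,A_i\rangle$, let $x_0\in\mathbb{R}^n$, $X_0=x_0x_0^t$, and let $b=\mathcal{A}(X_0)$. Suppose that $X_0$ minimizes $$\min f(X)\ \text{ subject to }\ X\succeq 0,\ \mathcal{A}(X)=b,$$ and that there does not exist a nonzero $A\in\operatorname{span}\{A_i\}_{i=1}^m$ such that $A\succeq 0$ and $\langle A,X_0\rangle=0$. Then there exists a dual certificate at $X_0$.
   Context: $\mathcal{S}^n$ is the space of real symmetric $n\times n$ matrices with inner product $\langle X,Y\rangle=\operatorname{tr}(Y^tX)$; $\perp$ denotes orthogonality for this inner product. $X\succeq 0$ (resp. $X\preceq 0$) means $X$ is positive (resp. negative) semidefinite. The adjoint of $\mathcal{A}$ is $\mathcal{A}^*\lambda=\sum_{i=1}^m\lambda_iA_i$. $\partial f$ denotes the convex subdifferential with respect to $\langle\cdot,\cdot\rangle$ on $\mathcal{S}^n$. A dual certificate at $X_0$ (for the problem $\min f(X)$ s.t. $X\succeq0$, $\mathcal{A}(X)=b$) is a pair $(\lambda,Q)\in\mathbb{R}^m\times\mathcal{S}^n$ such that $\mathcal{A}^*\lambda+Q\in-\partial f(X_0)$, $Q\preceq 0$, and $Q\perp X_0$. *)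

theory Defs
  imports "HOL-Analysis.Analysis"
begin

definition sym_mats :: "(real^'n^'n) set" where
  "sym_mats = {X. transpose X = X}"

text \<open>The inner product provided by the type class instance for \<open>real^'n^'n\<close> is the
  trace inner product; no separate constant is introduced for it.\<close>

lemma inner_matrix_eq_trace:
  fixes X Y :: "real^'n^'n"
  shows "X \<bullet> Y = trace (transpose Y ** X)"
proof -
  have "X \<bullet> Y = (\<Sum>k\<in>UNIV. \<Sum>i\<in>UNIV. X $ k $ i * Y $ k $ i)"
    by (simp add: inner_vec_def)
  also have "\<dots> = (\<Sum>i\<in>UNIV. \<Sum>k\<in>UNIV. X $ k $ i * Y $ k $ i)"
    by (rule sum.swap)
  finally show ?thesis
    by (simp add: trace_def matrix_matrix_mult_def transpose_def mult.commute)
qed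

definition psd :: "real^'n^'n \<Rightarrow> bool" where
  "psd X \<longleftrightarrow> X \<in> sym_mats \<and> (\<forall>v. 0 \<le> v \<bullet> (X *v v))"

definition nsd :: "real^'n^'n \<Rightarrow> bool" where
  "nsd X \<longleftrightarrow> X \<in> sym_mats \<and> (\<forall>v. v \<bullet> (X *v v) \<le> 0)"

definition outer :: "real^'n \<Rightarrow> real^'n^'n" where
  "outer x = (\<chi> i j. x $ i * x $ j)"

definition meas :: "('m \<Rightarrow> real^'n^'n) \<Rightarrow> real^'n^'n \<Rightarrow> real^'m" where
  "meas A X = (\<chi> i. X \<bullet> A i)"

definition meas_adj :: "('m::finite \<Rightarrow> real^'n^'n) \<Rightarrow> real^'m \<Rightarrow> real^'n^'n" where
  "meas_adj A l = (\<Sum>i\<in>UNIV. (l $ i) *\<^sub>R A i)"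

text \<open>The function \<open>f\<close> is total on all square matrices, but the space under consideration is
  that of symmetric matrices: both the subgradients and the comparison points are restricted
  to it, so the values of \<open>f\<close> at non-symmetric matrices play no role.\<close>

definition subdifferential :: "(real^'n^'n \<Rightarrow> real) \<Rightarrow> real^'n^'n \<Rightarrow> (real^'n^'n) set" where
  "subdifferential f X = {G \<in> sym_mats. \<forall>Y\<in>sym_mats. f X + G \<bullet> (Y - X) \<le> f Y}"

definition dual_certificate ::
  "(real^'n^'n \<Rightarrow> real) \<Rightarrow> ('m::finite \<Rightarrow> real^'n^'n) \<Rightarrow> real^'n^'n
    \<Rightarrow> real^'m \<Rightarrow> real^'n^'n \<Rightarrow> bool" where
  "dual_certificate f A X\<^sub>0 l Q \<longleftrightarrow>
     meas_adj A l + Q \<in> uminus ` subdifferential f X\<^sub>0 \<and> nsd Q \<and> orthogonal Q X\<^sub>0"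

end

theory Submission
  imports Defs
begin

text \<open>Two separation arguments. Separating the strict epigraph of \<open>f\<close> from the feasible set at
  height \<open>f X\<^sub>0\<close> yields a subgradient whose negative \<open>G\<close> is maximised over the feasible set at
  \<open>X\<^sub>0\<close>. Separating the cone of positive semidefinite matrices from the affine slice
  \<open>{X. \<A> X = b, G \<bullet> X > G \<bullet> X\<^sub>0}\<close> then yields a positive semidefinite \<open>M \<noteq> 0\<close> orthogonal to \<open>X\<^sub>0\<close>
  such that \<open>M + \<mu> G\<close> lies in the span of the \<open>A\<^sub>i\<close> for some \<open>\<mu> \<ge> 0\<close>. The hypothesis on the span
  excludes \<open>\<mu> = 0\<close>, so that \<open>Q = - M / \<mu>\<close> is the wanted certificate. To separate in the full matrix
  space, \<open>f\<close> and the cone are pulled back along \<open>X \<mapsto> (X + X\<^sup>t) / 2\<close>; the separating matrices are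
  then automatically symmetric.\<close>

section \<open>Separation and multipliers in a Euclidean space\<close>

text \<open>The separating hyperplane in the product with the reals cannot be vertical, because
  \<open>f\<close> is finite everywhere. Normalising its last coefficient gives
  \<open>g\<close>.\<close>

lemma convex_minimizer_subgradient:
  fixes f :: "'a::euclidean_space \<Rightarrow> real"
  assumes f: "convex_on UNIV f" and C: "convex C" "x \<in> C"
    and min: "\<And>y. y \<in> C \<Longrightarrow> f x \<le> f y"
  obtains g where "\<And>y. f x + g \<bullet> (y - x) \<le> f y" "\<And>y. y \<in> C \<Longrightarrow> 0 \<le> g \<bullet> (y - x)"
proof -
  define E where "E = {p :: 'a \<times> real. f (fst p) < snd p}"
  have convE: "convex E"
    unfolding convex_alt
  proof (intro ballI allI impI)
    fix p q :: "'a \<times> real" and u :: real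
    assume p: "p \<in> E" and q: "q \<in> E" and u: "0 \<le> u \<and> u \<le> 1"
    have "f ((1 - u) *\<^sub>R fst p + u *\<^sub>R fst q) \<le> (1 - u) * f (fst p) + u * f (fst q)"
      using convex_onD[OF f, of u "fst p" "fst q"] u by simp
    also have "\<dots> < (1 - u) * snd p + u * snd q"
    proof (cases "u = 0")
      case True
      then show ?thesis using p by (simp add: E_def)
    next
      case False
      then have "u * f (fst q) < u * snd q" using q u by (simp add: E_def)
      moreover have "(1 - u) * f (fst p) \<le> (1 - u) * snd p"
        using p u by (intro mult_left_mono) (auto simp: E_def)
      ultimately show ?thesis by linarith
    qed
    finally show "(1 - u) *\<^sub>R p + u *\<^sub>R q \<in> E" by (simp add: E_def)
  qed
  have "(x, f x + 1) \<in> E" by (simp add: E_def)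
  moreover have "E \<inter> C \<times> {f x} = {}"
    using min by (force simp: E_def)
  moreover have "convex (C \<times> {f x})" using C by (intro convex_Times) auto
  ultimately obtain a c where a: "a \<noteq> 0"
    and aC: "\<And>p. p \<in> C \<times> {f x} \<Longrightarrow> a \<bullet> p \<le> c" and aE: "\<And>p. p \<in> E \<Longrightarrow> c \<le> a \<bullet> p"
    using separating_hyperplane_sets[of "C \<times> {f x}" E] convE C by blast
  obtain g s where gs: "a = (g, s)" by (cases a)
  have upper: "g \<bullet> y + s * f x \<le> c" if "y \<in> C" for y
    using aC[of "(y, f x)"] that gs by simp
  have lower: "c \<le> g \<bullet> y + s * t" if "f y < t" for y t
    using aE[of "(y, t)"] that gs by (simp add: E_def)
  have "g \<bullet> x + s * f x \<le> g \<bullet> x + s * (f x + 1)"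
    using upper[OF C(2)] lower[of x "f x + 1"] by linarith
  then have "0 \<le> s" by (simp add: algebra_simps)
  moreover have "s \<noteq> 0"
  proof
    assume s: "s = 0"
    \<comment> \<open>The epigraph projects onto the whole space, so a vertical hyperplane can be
      tested at \<open>x - g\<close>, against the direction of \<open>g\<close>.\<close>
    have "g \<bullet> x \<le> g \<bullet> (x - g)"
      using upper[OF C(2)] lower[of "x - g" "f (x - g) + 1"] s by simp
    then have "g \<bullet> g \<le> 0" by (simp add: inner_diff_right)
    then have "g = 0" by (metis inner_gt_zero_iff not_le)
    then show False using a gs s by (simp add: zero_prod_def)
  qed
  ultimately have s: "0 < s" by simp
  \<comment> \<open>\<open>E\<close> is the strict epigraph; its bound passes to the graph of
    \<open>f\<close> in the limit.\<close>
  have lower': "c \<le> g \<bullet> y + s * f y" for y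
  proof (rule field_le_epsilon)
    fix e :: real
    assume "0 < e"
    then show "c \<le> g \<bullet> y + s * f y + e"
      using lower[of y "f y + e / s"] s by (simp add: algebra_simps)
  qed
  show thesis
  proof (rule that[of "(- 1 / s) *\<^sub>R g"])
    fix y
    have "g \<bullet> x + s * f x \<le> g \<bullet> y + s * f y"
      using upper[OF C(2)] lower'[of y] by linarith
    then show "f x + ((- 1 / s) *\<^sub>R g) \<bullet> (y - x) \<le> f y"
      using s by (simp add: field_simps inner_diff_right)
  next
    fix y
    assume "y \<in> C"
    then have "g \<bullet> y \<le> g \<bullet> x"
      using upper[of y] lower'[of x] by linarith
    then show "0 \<le> ((- 1 / s) *\<^sub>R g) \<bullet> (y - x)"
      using s by (simp add: field_simps inner_diff_right)
  qed
qed

text \<open>Modulo \<open>V\<close> only the components of \<open>m\<close> and \<open>g\<close>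
  orthogonal to \<open>V\<close> matter. There \<open>m\<close> is nonpositive on an open half-space
  with normal \<open>g\<close>, so it must be a nonpositive multiple of \<open>g\<close>. The
  assumption \<open>ex\<close> makes that half-space nonempty.\<close>

lemma farkas_one_constraint:
  fixes m g :: "'a::euclidean_space"
  assumes V: "subspace V"
    and ex: "\<exists>d. (\<forall>v\<in>V. orthogonal d v) \<and> 0 < g \<bullet> d"
    and le: "\<And>d. (\<And>v. v \<in> V \<Longrightarrow> orthogonal d v) \<Longrightarrow> 0 < g \<bullet> d \<Longrightarrow> m \<bullet> d \<le> 0"
  obtains \<mu> where "0 \<le> \<mu>" "m + \<mu> *\<^sub>R g \<in> V"
proof -
  obtain g1 g2 where g: "g1 \<in> V" "\<And>v. v \<in> V \<Longrightarrow> orthogonal g2 v" "g = g1 + g2"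
    using orthogonal_subspace_decomp_exists[of V g] span_eq_iff[of V] V by metis
  obtain m1 m2 where m: "m1 \<in> V" "\<And>v. v \<in> V \<Longrightarrow> orthogonal m2 v" "m = m1 + m2"
    using orthogonal_subspace_decomp_exists[of V m] span_eq_iff[of V] V by metis
  have "g2 \<noteq> 0"
    using ex g by (force simp: orthogonal_def inner_commute)
  then have g2: "0 < g2 \<bullet> g2" by simp
  \<comment> \<open>Project \<open>m2\<close> onto \<open>g2\<close>; \<open>w\<close> is the
    remainder, to be shown zero.\<close>
  define \<alpha> where "\<alpha> = m2 \<bullet> g2 / (g2 \<bullet> g2)"
  define w where "w = m2 - \<alpha> *\<^sub>R g2"
  have wg: "g2 \<bullet> w = 0"
    using g2 by (simp add: w_def \<alpha>_def inner_diff_right inner_commute)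
  have mw: "m2 \<bullet> w = w \<bullet> w"
  proof -
    have "m2 = w + \<alpha> *\<^sub>R g2" by (simp add: w_def)
    then show ?thesis by (simp add: inner_add_left wg)
  qed
  have wV: "orthogonal w v" if "v \<in> V" for v
    using g(2)[OF that] m(2)[OF that] by (simp add: w_def orthogonal_def inner_diff_left)
  \<comment> \<open>The whole line \<open>g2 + t *\<^sub>R w\<close> is admissible in
    \<open>le\<close>, so an affine function of \<open>t\<close> is bounded above and its slope
    \<open>w \<bullet> w\<close> vanishes.\<close>
  have key: "m2 \<bullet> g2 + t * (w \<bullet> w) \<le> 0" for t
  proof -
    have "orthogonal (g2 + t *\<^sub>R w) v" if "v \<in> V" for v
      using g(2)[OF that] wV[OF that] by (simp add: orthogonal_def inner_add_left)
    moreover have "g \<bullet> (g2 + t *\<^sub>R w) = g2 \<bullet> g2"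
      using g(2)[OF g(1)] wV[OF g(1)] wg
      by (simp add: g(3) orthogonal_def inner_add_left inner_add_right inner_commute)
    moreover have "m \<bullet> (g2 + t *\<^sub>R w) = m2 \<bullet> g2 + t * (w \<bullet> w)"
      using g(2)[OF m(1)] wV[OF m(1)] mw
      by (simp add: m(3) orthogonal_def inner_add_left inner_add_right inner_commute)
    ultimately show ?thesis
      using le[of "g2 + t *\<^sub>R w"] g2 by simp
  qed
  have "w = 0"
  proof (rule ccontr)
    assume "w \<noteq> 0"
    then have "0 < w \<bullet> w" by simp
    then show False
      using key[of "(1 - m2 \<bullet> g2) / (w \<bullet> w)"] by simp
  qed
  then have m2: "m2 = \<alpha> *\<^sub>R g2" by (simp add: w_def)
  have "m2 \<bullet> g2 \<le> 0" using key[of 0] by simp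
  then have "\<alpha> \<le> 0"
    using g2 by (simp add: \<alpha>_def divide_nonpos_pos)
  moreover have "m + (- \<alpha>) *\<^sub>R g = m1 + (- \<alpha>) *\<^sub>R g1"
    by (simp add: m(3) g(3) m2 algebra_simps)
  then have "m + (- \<alpha>) *\<^sub>R g \<in> V"
    using V m(1) g(1) by (metis subspace_add subspace_scale)
  ultimately show thesis
    using that[of "- \<alpha>"] by simp
qed

text \<open>A Lagrange multiplier rule for maximising \<open>g\<close> over a slice of a cone;
  \<open>cq\<close> is the constraint qualification, stated on the dual side.\<close>

lemma cone_slice_multiplier:
  fixes K V :: "'a::euclidean_space set"
  assumes K: "convex K" "cone K" and V: "subspace V" and x: "x \<in> K"
    and max: "\<And>y. y \<in> K \<Longrightarrow> (\<And>v. v \<in> V \<Longrightarrow> orthogonal (y - x) v) \<Longrightarrow> g \<bullet> y \<le> g \<bullet> x"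
    and cq: "\<And>m. m \<in> V \<Longrightarrow> (\<And>y. y \<in> K \<Longrightarrow> 0 \<le> m \<bullet> y) \<Longrightarrow> m \<bullet> x = 0 \<Longrightarrow> m = 0"
  obtains q where "\<And>y. y \<in> K \<Longrightarrow> q \<bullet> y \<le> 0" "q \<bullet> x = 0" "g - q \<in> V"
proof (cases "\<exists>d. (\<forall>v\<in>V. orthogonal d v) \<and> 0 < g \<bullet> d")
  \<comment> \<open>The objective is constant on the slice: \<open>g\<close> lies in
    \<open>V\<close>, and \<open>q = 0\<close> works.\<close>
  case False
  obtain g1 g2 where g: "g1 \<in> V" "\<And>v. v \<in> V \<Longrightarrow> orthogonal g2 v" "g = g1 + g2"
    using orthogonal_subspace_decomp_exists[of V g] span_eq_iff[of V] V by metis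
  have "g \<bullet> g2 = g2 \<bullet> g2"
    using g(2)[OF g(1)] by (simp add: g(3) inner_add_left orthogonal_def inner_commute[of g1])
  then have "g2 \<bullet> g2 \<le> 0" using False g(2) by force
  then have "g2 = 0" by (metis inner_gt_zero_iff not_le)
  then show thesis using that[of 0] g by simp
next
  case True
  then obtain d0 where d0: "\<And>v. v \<in> V \<Longrightarrow> orthogonal d0 v" "0 < g \<bullet> d0" by blast
  \<comment> \<open>The points of the affine slice that beat \<open>x\<close>; maximality of
    \<open>x\<close> keeps them out of \<open>K\<close>.\<close>
  define H where "H = (+) x ` {d. (\<forall>v\<in>V. orthogonal d v) \<and> 0 < g \<bullet> d}"
  have "convex {d. (\<forall>v\<in>V. orthogonal d v) \<and> 0 < g \<bullet> d}"
    unfolding convex_def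
  proof (intro ballI allI impI, clarsimp, intro conjI ballI)
    fix a b and u w :: real and v
    assume "\<forall>v\<in>V. orthogonal a v" "\<forall>v\<in>V. orthogonal b v" "v \<in> V"
    then show "orthogonal (u *\<^sub>R a + w *\<^sub>R b) v"
      by (simp add: orthogonal_def inner_add_left)
  next
    fix a b and u w :: real
    assume *: "0 < g \<bullet> a" "0 < g \<bullet> b" "0 \<le> u" "0 \<le> w" "u + w = 1"
    show "0 < g \<bullet> (u *\<^sub>R a + w *\<^sub>R b)"
    proof (cases "u = 0")
      case False
      then have "0 < u * (g \<bullet> a)" "0 \<le> w * (g \<bullet> b)" using * by auto
      then show ?thesis by (simp add: inner_add_right)
    qed (use * in simp)
  qed
  then have "convex H" by (simp add: H_def convex_translation)
  moreover have "H \<noteq> {}" using True by (auto simp: H_def)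
  moreover have "H \<inter> K = {}"
    using max by (force simp: H_def inner_add_right)
  ultimately obtain m c where m: "m \<noteq> 0" and mH: "\<And>y. y \<in> H \<Longrightarrow> m \<bullet> y \<le> c"
    and mK: "\<And>y. y \<in> K \<Longrightarrow> c \<le> m \<bullet> y"
    using separating_hyperplane_sets[of H K] K x by blast
  have scale: "t *\<^sub>R y \<in> K" if "y \<in> K" "0 \<le> t" for t y
    using K(2) that by (simp add: cone_def)
  have c: "c \<le> 0" using mK[OF scale[OF x, of 0]] by simp
  have pos: "0 \<le> m \<bullet> y" if "y \<in> K" for y
  proof (rule ccontr)
    assume "\<not> 0 \<le> m \<bullet> y"
    \<comment> \<open>Scaling \<open>y\<close> by this factor gives a point of \<open>K\<close>
      where \<open>m\<close> has the value \<open>c - 1\<close>.\<close>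
    then have "0 \<le> (c - 1) / (m \<bullet> y)" and n: "m \<bullet> y \<noteq> 0"
      using c by (auto simp: divide_nonpos_neg)
    from mK[OF scale[OF that this(1)]] n show False by simp
  qed
  have neg: "m \<bullet> x + m \<bullet> d \<le> 0" if "\<And>v. v \<in> V \<Longrightarrow> orthogonal d v" "0 < g \<bullet> d" for d
    using mH[of "x + d"] that c by (force simp: H_def inner_add_right)
  \<comment> \<open>\<open>x\<close> is a limit of the points \<open>x + t *\<^sub>R d0\<close> of
    \<open>H\<close>, with \<open>t\<close> tending to 0 from above.\<close>
  have "m \<bullet> x \<le> 0"
  proof (rule field_le_epsilon)
    fix e :: real
    assume e: "0 < e"
    define t where "t = e / (\<bar>m \<bullet> d0\<bar> + 1)"
    have t: "0 < t" using e by (simp add: t_def add_nonneg_pos)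
    have "m \<bullet> x + t * (m \<bullet> d0) \<le> 0"
      using neg[of "t *\<^sub>R d0"] d0 t by (simp add: orthogonal_def)
    moreover have "t * \<bar>m \<bullet> d0\<bar> \<le> e"
      using e by (simp add: t_def field_simps)
    moreover have "- (t * (m \<bullet> d0)) \<le> t * \<bar>m \<bullet> d0\<bar>"
      using t abs_ge_minus_self[of "t * (m \<bullet> d0)"] by (simp add: abs_mult)
    ultimately show "m \<bullet> x \<le> 0 + e" by linarith
  qed
  with pos[OF x] have mx: "m \<bullet> x = 0" by simp
  have le: "m \<bullet> d \<le> 0" if "\<And>v. v \<in> V \<Longrightarrow> orthogonal d v" "0 < g \<bullet> d" for d
    using neg[OF that] mx by simp
  obtain \<mu> where \<mu>: "0 \<le> \<mu>" "m + \<mu> *\<^sub>R g \<in> V"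
    using farkas_one_constraint[OF V True le] by metis
  \<comment> \<open>For \<open>\<mu> = 0\<close> the nonzero \<open>m\<close> would itself lie in
    \<open>V\<close>, against \<open>cq\<close>.\<close>
  have "\<mu> \<noteq> 0" using cq[OF _ pos mx] \<mu> m by auto
  then have "0 < \<mu>" using \<mu> by simp
  show thesis
  proof (rule that[of "(- 1 / \<mu>) *\<^sub>R m"])
    show "((- 1 / \<mu>) *\<^sub>R m) \<bullet> y \<le> 0" if "y \<in> K" for y
      using pos[OF that] \<open>0 < \<mu>\<close> by simp
    show "((- 1 / \<mu>) *\<^sub>R m) \<bullet> x = 0" using mx by simp
    have "g - (- 1 / \<mu>) *\<^sub>R m = (1 / \<mu>) *\<^sub>R (m + \<mu> *\<^sub>R g)"
      using \<open>0 < \<mu>\<close> by (simp add: algebra_simps)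
    then show "g - (- 1 / \<mu>) *\<^sub>R m \<in> V" using \<mu>(2) V subspace_scale by metis
  qed
qed

section \<open>Symmetric parts and the positive semidefinite cone\<close>

lemma transpose_add: "transpose (X + Y) = transpose X + transpose Y"
  for X Y :: "'a::plus^'n^'m"
  by (simp add: transpose_def vec_eq_iff)

lemma transpose_diff: "transpose (X - Y) = transpose X - transpose Y"
  for X Y :: "'a::minus^'n^'m"
  by (simp add: transpose_def vec_eq_iff)

lemma inner_transpose_transpose: "transpose X \<bullet> transpose Y = X \<bullet> Y"
  for X Y :: "real^'n^'m"
  unfolding inner_vec_def transpose_def by (simp, rule sum.swap)

lemma outer_inner: "X \<bullet> outer v = v \<bullet> (X *v v)"
  by (simp add: inner_vec_def outer_def matrix_vector_mult_def sum_distrib_left ac_simps)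

definition sym_part :: "real^'n^'n \<Rightarrow> real^'n^'n" where
  "sym_part X = (1 / 2) *\<^sub>R (X + transpose X)"

lemma linear_sym_part: "linear sym_part"
  by (rule linearI)
    (simp_all add: sym_part_def transpose_add transpose_scalar algebra_simps)

lemma sym_part_in_sym_mats: "sym_part X \<in> sym_mats"
  by (simp add: sym_mats_def sym_part_def transpose_add transpose_scalar add.commute)

lemma sym_part_id: "X \<in> sym_mats \<Longrightarrow> sym_part X = X"
  by (simp add: sym_mats_def sym_part_def scaleR_2[symmetric])

lemma sym_part_inner: "Y \<in> sym_mats \<Longrightarrow> Y \<bullet> sym_part X = Y \<bullet> X"
  using inner_transpose_transpose[of Y X]
  by (simp add: sym_mats_def sym_part_def inner_add_right)

lemma outer_in_sym_mats: "outer v \<in> sym_mats"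
  by (simp add: outer_def sym_mats_def transpose_def mult.commute)

lemma sym_part_quadratic_form: "v \<bullet> (sym_part X *v v) = v \<bullet> (X *v v)"
  by (metis outer_inner outer_in_sym_mats sym_part_inner inner_commute)

text \<open>The kernel of \<open>sym_part\<close> consists of the skew matrices. Testing on
  \<open>G - transpose G\<close>, twice the skew part of \<open>G\<close>, forces that part to
  vanish.\<close>

lemma sym_mats_if_skew_nonpos:
  assumes "\<And>X. sym_part X = 0 \<Longrightarrow> G \<bullet> X \<le> 0"
  shows "G \<in> sym_mats"
proof -
  define X where "X = G - transpose G"
  have "sym_part X = 0"
    by (simp add: X_def sym_part_def transpose_diff)
  then have "G \<bullet> X \<le> 0" by (rule assms)
  moreover have "X \<bullet> X = 2 * (G \<bullet> X)"
    using inner_transpose_transpose[of G G] inner_transpose_transpose[of "transpose G" G]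
    by (simp add: X_def inner_diff_left inner_diff_right inner_commute)
  ultimately have "X = 0" by (metis inner_gt_zero_iff mult_2 add_nonpos_nonpos not_le)
  then show ?thesis by (simp add: X_def sym_mats_def)
qed

text \<open>The preimage of the positive semidefinite cone under \<open>sym_part\<close>: symmetry
  is dropped to get a cone in the full matrix space.\<close>

definition psd_form :: "(real^'n^'n) set" where
  "psd_form = {X. \<forall>v. 0 \<le> v \<bullet> (X *v v)}"

text \<open>An intersection of half-spaces through 0, from which convexity and the cone property are
  immediate.\<close>

lemma psd_form_outer_eq: "psd_form = {X. \<forall>v. 0 \<le> outer v \<bullet> X}"
  by (simp add: psd_form_def flip: outer_inner) (simp add: inner_commute)

lemma convex_psd_form: "convex psd_form"
  unfolding psd_form_outer_eq convex_def by (simp add: inner_add_right)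

lemma cone_psd_form: "cone psd_form"
  unfolding psd_form_outer_eq cone_def by simp

lemma psd_sym_part: "X \<in> psd_form \<Longrightarrow> psd (sym_part X)"
  by (simp add: psd_form_def psd_def sym_part_in_sym_mats sym_part_quadratic_form)

lemma psd_in_psd_form: "psd X \<Longrightarrow> X \<in> psd_form"
  by (simp add: psd_form_def psd_def)

lemma outer_inner_outer: "outer v \<bullet> outer w = (v \<bullet> w)\<^sup>2"
  by (simp add: outer_def inner_vec_def power2_eq_square sum_product ac_simps)

lemma outer_in_psd_form: "outer v \<in> psd_form"
  by (simp add: psd_form_outer_eq outer_inner_outer)

section \<open>The measurement map, and the certificate\<close>

lemma span_range_eq_meas_adj: "span (range A) = range (meas_adj A)"
proof
  have "subspace (range (meas_adj A))"
    by (intro linear_subspace_image subspace_UNIV linearI)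
      (simp_all add: meas_adj_def sum.distrib scaleR_add_left scaleR_sum_right)
  moreover have "A i = meas_adj A (axis i 1)" for i
    by (simp add: meas_adj_def axis_def if_distrib[of "\<lambda>c. c *\<^sub>R _"] cong: if_cong)
  then have "range A \<subseteq> range (meas_adj A)" by auto
  ultimately show "span (range A) \<subseteq> range (meas_adj A)"
    by (intro span_minimal)
  show "range (meas_adj A) \<subseteq> span (range A)"
    by (auto simp: meas_adj_def intro: span_sum span_scale span_base)
qed

lemma meas_eq_iff_orthogonal_span:
  "meas A X = meas A Y \<longleftrightarrow> (\<forall>v\<in>span (range A). orthogonal (X - Y) v)"
proof
  assume "meas A X = meas A Y"
  then have "orthogonal (X - Y) v" if "v \<in> range A" for v
    using that by (auto simp: meas_def vec_eq_iff orthogonal_def inner_diff_left)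
  then show "\<forall>v\<in>span (range A). orthogonal (X - Y) v"
    by (metis orthogonal_to_span)
next
  assume "\<forall>v\<in>span (range A). orthogonal (X - Y) v"
  then show "meas A X = meas A Y"
    by (auto simp: meas_def vec_eq_iff orthogonal_def inner_diff_left intro: span_base)
qed

theorem theorem3:
  fixes f :: "real^'n^'n \<Rightarrow> real"
    and A :: "'m::finite \<Rightarrow> real^'n^'n"
    and x\<^sub>0 :: "real^'n"
    and X\<^sub>0 :: "real^'n^'n"
    and b :: "real^'m"
  assumes "convex_on sym_mats f"
    and "continuous_on sym_mats f"
    and "\<And>i. A i \<in> sym_mats"
    and "X\<^sub>0 = outer x\<^sub>0"
    and "b = meas A X\<^sub>0"
    and "is_arg_min f (\<lambda>X. psd X \<and> meas A X = b) X\<^sub>0"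
    and "\<not> (\<exists>B \<in> span (range A). B \<noteq> 0 \<and> psd B \<and> B \<bullet> X\<^sub>0 = 0)"
  shows "\<exists>l Q. dual_certificate f A X\<^sub>0 l Q"
proof -
  let ?V = "span (range A)"
  have X0: "psd X\<^sub>0" and min: "\<And>X. psd X \<Longrightarrow> meas A X = b \<Longrightarrow> f X\<^sub>0 \<le> f X"
    using assms(6) by (force simp: is_arg_min_def)+
  have X0K: "X\<^sub>0 \<in> psd_form" by (rule psd_in_psd_form[OF X0])
  have X0s: "sym_part X\<^sub>0 = X\<^sub>0" using X0 by (simp add: psd_def sym_part_id)
  have meas_sym: "meas A (sym_part X) = meas A X" for X
    using sym_part_inner[OF assms(3)] by (simp add: meas_def vec_eq_iff inner_commute)
  have "subspace (sym_mats :: (real^'n^'n) set)"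
    unfolding subspace_def sym_mats_def
    by (auto simp: transpose_add transpose_scalar transpose_def vec_eq_iff)
  then have span_sym: "?V \<subseteq> sym_mats"
    using assms(3) by (intro span_minimal) auto
  \<comment> \<open>This set contains nonsymmetric matrices, but \<open>sym_part\<close> sends each
    of them to a feasible point, by \<open>psd_sym_part\<close> and \<open>meas_sym\<close>.\<close>
  define C where "C = psd_form \<inter> {X. meas A X = b}"
  have "convex {X. meas A X = b}"
  proof (rule convexI)
    fix X Y :: "real^'n^'n" and u v :: real
    assume "X \<in> {X. meas A X = b}" "Y \<in> {X. meas A X = b}" "u + v = 1"
    then show "u *\<^sub>R X + v *\<^sub>R Y \<in> {X. meas A X = b}"
      by (simp add: meas_def vec_eq_iff inner_add_left flip: distrib_right)
  qed
  then have C: "convex C" "X\<^sub>0 \<in> C"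
    using convex_psd_form X0K assms(5) by (auto simp: C_def intro: convex_Int)
  have "convex_on UNIV (\<lambda>X. f (sym_part X))"
  proof (rule convex_onI)
    fix t :: real and X Y :: "real^'n^'n"
    assume "0 < t" "t < 1"
    then show "f (sym_part ((1 - t) *\<^sub>R X + t *\<^sub>R Y))
        \<le> (1 - t) * f (sym_part X) + t * f (sym_part Y)"
      using convex_onD[OF assms(1), of t "sym_part X" "sym_part Y"]
      by (simp add: linear_add[OF linear_sym_part] linear_scale[OF linear_sym_part]
          sym_part_in_sym_mats)
  qed simp
  moreover have "f (sym_part X\<^sub>0) \<le> f (sym_part Y)" if "Y \<in> C" for Y
    using that min[OF psd_sym_part] meas_sym X0s by (simp add: C_def)
  ultimately obtain G where
    G: "\<And>Y. f (sym_part X\<^sub>0) + G \<bullet> (Y - X\<^sub>0) \<le> f (sym_part Y)"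
    and GC: "\<And>Y. Y \<in> C \<Longrightarrow> 0 \<le> G \<bullet> (Y - X\<^sub>0)"
    using convex_minimizer_subgradient[of "\<lambda>X. f (sym_part X)", OF _ C] by blast
  \<comment> \<open>Moving from \<open>X\<^sub>0\<close> along a skew \<open>X\<close> leaves the
    pulled-back objective unchanged.\<close>
  have "G \<bullet> X \<le> 0" if "sym_part X = 0" for X
    using G[of "X\<^sub>0 + X"] that by (simp add: linear_add[OF linear_sym_part])
  then have "G \<in> sym_mats" by (rule sym_mats_if_skew_nonpos)
  moreover have "f X\<^sub>0 + G \<bullet> (Y - X\<^sub>0) \<le> f Y" if "Y \<in> sym_mats" for Y
    using G[of Y] X0s sym_part_id[OF that] by simp
  ultimately have Gsub: "G \<in> subdifferential f X\<^sub>0"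
    by (simp add: subdifferential_def)
  \<comment> \<open>Here \<open>G\<close> is the subgradient itself, so the linear objective to be
    maximised is \<open>- G\<close>.\<close>
  have max: "- G \<bullet> Y \<le> - G \<bullet> X\<^sub>0"
    if "Y \<in> psd_form" "\<And>v. v \<in> ?V \<Longrightarrow> orthogonal (Y - X\<^sub>0) v" for Y
    using GC[of Y] that meas_eq_iff_orthogonal_span[of A Y X\<^sub>0] assms(5)
    by (simp add: C_def inner_diff_right)
  have cq: "M = 0"
    if "M \<in> ?V" "\<And>Y. Y \<in> psd_form \<Longrightarrow> 0 \<le> M \<bullet> Y" "M \<bullet> X\<^sub>0 = 0" for M
  proof -
    \<comment> \<open>Nonnegativity on the rank-one matrices \<open>outer v\<close> is nonnegativity
      of the quadratic form of \<open>M\<close>.\<close>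
    have "psd M"
      using that span_sym outer_in_psd_form by (auto simp: psd_def simp flip: outer_inner)
    then show ?thesis using assms(7) that by blast
  qed
  obtain Q where Q: "\<And>Y. Y \<in> psd_form \<Longrightarrow> Q \<bullet> Y \<le> 0" "Q \<bullet> X\<^sub>0 = 0" "- G - Q \<in> ?V"
    using cone_slice_multiplier[OF convex_psd_form cone_psd_form subspace_span X0K max cq]
    by blast
  \<comment> \<open>A skew matrix has zero quadratic form, hence belongs to
    \<open>psd_form\<close>.\<close>
  have "Q \<bullet> X \<le> 0" if "sym_part X = 0" for X
  proof (rule Q(1))
    show "X \<in> psd_form"
      by (simp add: psd_form_def that flip: sym_part_quadratic_form[of _ X])
  qed
  then have "Q \<in> sym_mats" by (rule sym_mats_if_skew_nonpos)
  then have "nsd Q"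
    using Q(1)[OF outer_in_psd_form] by (simp add: nsd_def flip: outer_inner)
  moreover obtain l where "- G - Q = meas_adj A l"
    using Q(3) span_range_eq_meas_adj by blast
  then have "meas_adj A l + Q = - G" by (metis diff_add_cancel)
  ultimately have "dual_certificate f A X\<^sub>0 l Q"
    using Gsub Q(2) by (auto simp: dual_certificate_def orthogonal_def)
  then show ?thesis by blast
qed

end
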